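(* Let $\mathbb{F}_q$ be a finite field. Let $\mathcal{M}$ be any proper, minor-closed class of $\mathbb{F}_q$-representable matroids, and let $k_{\mathcal{M}}$ be the minimum rank of any $\mathbb{F}_q$-representable excluded minor of $\mathcal{M}$. If $m:\mathbb{N}\to\mathbb{N}$ satisfies (i) $m(n)\geq k_{\mathcal{M}}$ for all sufficiently large $n$, and (ii) $n-m(n)\to\infty$ as $n\to\infty$, then $$\lim_{n\to\infty}\mathbb{P}_{A_n\sim[U_q]^{m(n)\times n}}\{M[A_n]\notin\mathcal{M}\}=1.$$
   Context: $\mathbb{F}_q$ is the finite field with $q$ elements. $[U_q]^{m\times n}$ denotes the uniform distribution on $\mathbb{F}_q^{m\times n}$ (entries i.i.d. uniform on $\mathbb{F}_q$), and $A \sim [U_q]^{m \times n}$ means that $A$ is drawn from it. For a matrix $A$ over $\mathbb{F}_q$ with $n$ columns, $M[A]$ is the column dependence matroid of $A$: its ground set is the set of column indices $\{1,\dots,n\}$, and a set of indices is independent iff the corresponding columns form a linearly independent family. All matroids are finite. A matroid is $\mathbb{F}_q$-representable if it is isomorphic to $M[A]$ for some matrix $A$ over $\mathbb{F}_q$. "$M$ is a minor of $N$" means that $M$ is isomorphic to a matroid obtained from $N$ by a sequence of deletions and contractions. A class $\mathcal{M}$ of $\mathbb{F}_q$-representable matroids (closed under isomorphism) is minor-closed if every minor of a member is a member, and proper if it does not contain all $\mathbb{F}_q$-representable matroids. An excluded minor (forbidden minor) of $\mathcal{M}$ is a matroid not in $\mathcal{M}$ all of whose proper minors are in $\mathcal{M}$.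 *)

theory Defs
  imports
    "HOL-Probability.Probability_Mass_Function"
    "Jordan_Normal_Form.VS_Connect"
begin

section \<open>Finite matroids\<close>

record 'e indep_sys =
  ground :: "'e set"
  indeps :: "'e set set"

definition matroid :: "'e indep_sys \<Rightarrow> bool" where
  "matroid M \<longleftrightarrow>
     finite (ground M) \<and>
     indeps M \<subseteq> Pow (ground M) \<and>
     {} \<in> indeps M \<and>
     (\<forall>I J. J \<in> indeps M \<longrightarrow> I \<subseteq> J \<longrightarrow> I \<in> indeps M) \<and>
     (\<forall>I\<in>indeps M. \<forall>J\<in>indeps M. card I < card J \<longrightarrow> (\<exists>e\<in>J - I. insert e I \<in> indeps M))"

definition matroid_rank :: "'e indep_sys \<Rightarrow> nat" where
  "matroid_rank M = Max (card ` indeps M)"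

definition isomorphic :: "'e indep_sys \<Rightarrow> 'f indep_sys \<Rightarrow> bool" where
  "isomorphic M N \<longleftrightarrow> matroid M \<and> matroid N \<and>
     (\<exists>f. bij_betw f (ground M) (ground N) \<and>
          (\<forall>I\<subseteq>ground M. I \<in> indeps M \<longleftrightarrow> f ` I \<in> indeps N))"

definition del_elem :: "'e indep_sys \<Rightarrow> 'e \<Rightarrow> 'e indep_sys" where
  "del_elem M e = \<lparr>ground = ground M - {e}, indeps = {I \<in> indeps M. e \<notin> I}\<rparr>"

text \<open>If \<open>e\<close> is a loop, that is, if \<open>{e}\<close> is dependent, then contracting \<open>e\<close> is the same as
  deleting it.\<close>

definition contract_elem :: "'e indep_sys \<Rightarrow> 'e \<Rightarrow> 'e indep_sys" where
  "contract_elem M e =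
     (if {e} \<in> indeps M
      then \<lparr>ground = ground M - {e}, indeps = {I. e \<notin> I \<and> insert e I \<in> indeps M}\<rparr>
      else del_elem M e)"

definition elem_minor :: "'e indep_sys \<Rightarrow> 'e indep_sys \<Rightarrow> bool" where
  "elem_minor M N \<longleftrightarrow> (\<exists>e\<in>ground M. N = del_elem M e \<or> N = contract_elem M e)"

text \<open>\<open>is_minor N M\<close>: \<open>N\<close> is a minor of \<open>M\<close>, up to isomorphism. A minor is proper if at least one
  element is removed.\<close>

definition is_minor :: "'f indep_sys \<Rightarrow> 'e indep_sys \<Rightarrow> bool" where
  "is_minor N M \<longleftrightarrow> (\<exists>N'. elem_minor\<^sup>*\<^sup>* M N' \<and> isomorphic N N')"

definition is_proper_minor :: "'f indep_sys \<Rightarrow> 'e indep_sys \<Rightarrow> bool" where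
  "is_proper_minor N M \<longleftrightarrow> (\<exists>N'. elem_minor\<^sup>+\<^sup>+ M N' \<and> isomorphic N N')"


section \<open>Column dependence matroids and representability\<close>

text \<open>Columns are indexed by \<open>0, \<dots>, n - 1\<close>, as in the matrix library. The injectivity condition is
  needed because \<open>lin_dep\<close> is a property of sets of vectors: a family with a repeated column is
  linearly dependent.\<close>

definition col_matroid :: "'a::field mat \<Rightarrow> nat indep_sys" where
  "col_matroid A =
     \<lparr>ground = {0..<dim_col A},
      indeps = {S. S \<subseteq> {0..<dim_col A} \<and> inj_on (col A) S \<and>
        \<not> module.lin_dep class_ring (module_vec TYPE('a) (dim_row A)) (col A ` S)}\<rparr>"

definition representable :: "'a::field itself \<Rightarrow> 'e indep_sys \<Rightarrow> bool" where
  "representable F M \<longleftrightarrow> (\<exists>A :: 'a mat. isomorphic M (col_matroid A))"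


section \<open>Classes of representable matroids\<close>

text \<open>Every finite matroid is isomorphic to one whose ground set consists of natural numbers, so an
  isomorphism-closed class of finite matroids is given by its members of type
  \<^typ>\<open>nat indep_sys\<close>.\<close>

definition representable_class :: "'a::field itself \<Rightarrow> nat indep_sys set \<Rightarrow> bool" where
  "representable_class F \<M> \<longleftrightarrow>
     (\<forall>M\<in>\<M>. representable F M) \<and>
     (\<forall>M N. M \<in> \<M> \<longrightarrow> isomorphic M N \<longrightarrow> N \<in> \<M>)"

definition minor_closed :: "nat indep_sys set \<Rightarrow> bool" where
  "minor_closed \<M> \<longleftrightarrow> (\<forall>M N. M \<in> \<M> \<longrightarrow> is_minor N M \<longrightarrow> N \<in> \<M>)"

definition proper_class :: "'a::field itself \<Rightarrow> nat indep_sys set \<Rightarrow> bool" where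
  "proper_class F \<M> \<longleftrightarrow> (\<exists>M. representable F M \<and> M \<notin> \<M>)"

definition excluded_minor :: "nat indep_sys set \<Rightarrow> nat indep_sys \<Rightarrow> bool" where
  "excluded_minor \<M> N \<longleftrightarrow> matroid N \<and> N \<notin> \<M> \<and> (\<forall>N'. is_proper_minor N' N \<longrightarrow> N' \<in> \<M>)"

definition min_excluded_rank :: "'a::field itself \<Rightarrow> nat indep_sys set \<Rightarrow> nat" where
  "min_excluded_rank F \<M> =
     (LEAST k. \<exists>N. representable F N \<and> excluded_minor \<M> N \<and> matroid_rank N = k)"


section \<open>Uniform random matrices\<close>

definition uniform_mat :: "nat \<Rightarrow> nat \<Rightarrow> 'a::{field,finite} mat pmf" where
  "uniform_mat m n = pmf_of_set (carrier_mat m n)"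


section \<open>Basic facts\<close>

lemma matroidI:
  assumes "finite (ground M)"
    and "\<And>I. I \<in> indeps M \<Longrightarrow> I \<subseteq> ground M"
    and "{} \<in> indeps M"
    and "\<And>I J. J \<in> indeps M \<Longrightarrow> I \<subseteq> J \<Longrightarrow> I \<in> indeps M"
    and "\<And>I J. I \<in> indeps M \<Longrightarrow> J \<in> indeps M \<Longrightarrow> card I < card J \<Longrightarrow>
           \<exists>e\<in>J - I. insert e I \<in> indeps M"
  shows "matroid M"
  unfolding matroid_def
proof (intro conjI allI impI ballI)
  show "indeps M \<subseteq> Pow (ground M)" using assms(2) by blast
qed (fact assms(1,3) | rule assms(4,5), assumption+)+

lemma matroidD:
  assumes "matroid M"
  shows "finite (ground M)"
    and "I \<in> indeps M \<Longrightarrow> I \<subseteq> ground M"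
    and "{} \<in> indeps M"
    and "J \<in> indeps M \<Longrightarrow> I \<subseteq> J \<Longrightarrow> I \<in> indeps M"
    and "I \<in> indeps M \<Longrightarrow> J \<in> indeps M \<Longrightarrow> card I < card J \<Longrightarrow>
           \<exists>e\<in>J - I. insert e I \<in> indeps M"
  using assms unfolding matroid_def by (simp_all add: subset_eq)

lemma matroid_finite_indep: "matroid M \<Longrightarrow> I \<in> indeps M \<Longrightarrow> finite I"
  using matroidD(1,2) finite_subset by metis

lemma matroid_del_elem:
  assumes M: "matroid M"
  shows "matroid (del_elem M e)"
proof (rule matroidI)
  fix I J assume I: "I \<in> indeps (del_elem M e)" and J: "J \<in> indeps (del_elem M e)"
    and less: "card I < card J"
  then obtain x where x: "x \<in> J - I" "insert x I \<in> indeps M"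
    using matroidD(5)[OF M, of I J] by (auto simp: del_elem_def)
  then have "insert x I \<in> indeps (del_elem M e)" using I J by (auto simp: del_elem_def)
  then show "\<exists>x\<in>J - I. insert x I \<in> indeps (del_elem M e)" using x by blast
next
  fix I J assume J: "J \<in> indeps (del_elem M e)" and IJ: "I \<subseteq> J"
  have "I \<in> indeps M" using matroidD(4)[OF M _ IJ] J by (simp add: del_elem_def)
  then show "I \<in> indeps (del_elem M e)" using IJ J by (auto simp: del_elem_def)
next
  fix I assume "I \<in> indeps (del_elem M e)"
  then show "I \<subseteq> ground (del_elem M e)"
    using matroidD(2)[OF M, of I] by (auto simp: del_elem_def)
qed (use matroidD(1,3)[OF M] in \<open>simp_all add: del_elem_def\<close>)

lemma matroid_contract_elem:
  assumes M: "matroid M"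
  shows "matroid (contract_elem M e)"
proof (cases "{e} \<in> indeps M")
  case False
  then show ?thesis by (simp add: contract_elem_def matroid_del_elem M)
next
  case True
  let ?N = "contract_elem M e"
  have g: "ground ?N = ground M - {e}" and
    i: "I \<in> indeps ?N \<longleftrightarrow> e \<notin> I \<and> insert e I \<in> indeps M" for I
    using True by (simp_all add: contract_elem_def)
  show ?thesis
  proof (rule matroidI)
    fix I J assume "I \<in> indeps ?N" and "J \<in> indeps ?N" and less: "card I < card J"
    then have I: "insert e I \<in> indeps M" "e \<notin> I" and J: "insert e J \<in> indeps M" "e \<notin> J"
      using i by auto
    have "finite I" "finite J"
      using matroid_finite_indep[OF M I(1)] matroid_finite_indep[OF M J(1)] by auto
    then have "card (insert e I) < card (insert e J)" using I J less by simp
    then obtain x where x: "x \<in> insert e J - insert e I" "insert x (insert e I) \<in> indeps M"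
      using matroidD(5)[OF M I(1) J(1)] by blast
    have "insert x I \<in> indeps ?N" using x I(2) by (auto simp: i insert_commute)
    then show "\<exists>x\<in>J - I. insert x I \<in> indeps ?N" using x by blast
  next
    fix I J assume J: "J \<in> indeps ?N" and IJ: "I \<subseteq> J"
    have "insert e I \<in> indeps M"
      using matroidD(4)[OF M, of "insert e J" "insert e I"] J IJ by (auto simp: i)
    then show "I \<in> indeps ?N" using J IJ by (auto simp: i)
  next
    fix I assume "I \<in> indeps ?N"
    then show "I \<subseteq> ground ?N" using matroidD(2)[OF M, of "insert e I"] by (auto simp: g i)
  next
    show "finite (ground ?N)" using matroidD(1)[OF M] by (simp add: g)
    show "{} \<in> indeps ?N" using True by (simp add: i)
  qed
qed

lemma matroid_col_matroid: "matroid (col_matroid (A :: 'a::field mat))"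
proof -
  interpret vec_space "TYPE('a)" "dim_row A" .
  let ?M = "col_matroid A"
  have car: "col A ` S \<subseteq> carrier_vec (dim_row A)" for S by auto
  have g: "ground ?M = {0..<dim_col A}" and
    i: "S \<in> indeps ?M \<longleftrightarrow> S \<subseteq> {0..<dim_col A} \<and> inj_on (col A) S \<and> lin_indpt (col A ` S)" for S
    by (simp_all add: col_matroid_def)
  show ?thesis
  proof (rule matroidI)
    show "finite (ground ?M)" by (simp add: g)
    show "S \<subseteq> ground ?M" if "S \<in> indeps ?M" for S using that by (simp add: i g)
    have "lin_indpt {}" by (rule finite_lin_indpt2) auto
    then show "{} \<in> indeps ?M" by (simp add: i)
  next
    fix I J assume J: "J \<in> indeps ?M" and IJ: "I \<subseteq> J"
    have "lin_indpt (col A ` I)"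
      using supset_ld_is_ld[of "col A ` I" "col A ` J"] image_mono[OF IJ, of "col A"] J by (auto simp: i)
    moreover have "I \<subseteq> {0..<dim_col A}" "inj_on (col A) I"
      using J IJ inj_on_subset[of "col A" J I] by (auto simp: i)
    ultimately show "I \<in> indeps ?M" by (simp add: i)
  next
    fix I J assume I: "I \<in> indeps ?M" and J: "J \<in> indeps ?M" and less: "card I < card J"
    have fin: "finite I" "finite J"
      using I J finite_subset[of _ "{0..<dim_col A}"] by (auto simp: i)
    show "\<exists>e\<in>J - I. insert e I \<in> indeps ?M"
    proof (rule ccontr)
      assume neg: "\<not> ?thesis"
      have sp: "col A e \<in> span (col A ` I)" if e: "e \<in> J" for e
      proof (cases "col A e \<in> col A ` I")
        case True
        then show ?thesis using span_mem[OF car] by blast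
      next
        case False
        have li: "lin_indpt (col A ` I)" using I by (simp add: i)
        have c: "col A e \<in> carrier_vec (dim_row A)" by simp
        have "e \<notin> I" using False by blast
        then have "insert e I \<notin> indeps ?M" using neg e by blast
        moreover have "inj_on (col A) (insert e I)" using I False \<open>e \<notin> I\<close> by (simp add: i)
        moreover have "insert e I \<subseteq> {0..<dim_col A}" using I J e by (auto simp: i)
        ultimately have "lin_dep (col A ` I \<union> {col A e})" by (simp add: i)
        then show ?thesis using lin_dep_iff_in_span[OF car li c False] by simp
      qed
      have "lin_indpt (col A ` J)" using J by (simp add: i)
      then have "\<exists>C. finite C \<and> C \<subseteq> carrier_vec (dim_row A) \<and> C \<subseteq> span (col A ` I) \<and>
          C \<inter> col A ` J = {} \<and> int (card C) \<le> int (card (col A ` I)) - int (card (col A ` J)) \<and>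
          span (col A ` J \<union> C) = span (col A ` I)"
        using sp by (intro replacement[OF finite_imageI[OF fin(2)] finite_imageI[OF fin(1)] car]) auto
      then have "card (col A ` J) \<le> card (col A ` I)" by force
      moreover have "card (col A ` I) = card I" "card (col A ` J) = card J"
        using I J by (simp_all add: i card_image)
      ultimately show False using less by linarith
    qed
  qed
qed

lemma finite_carrier_mat: "finite (carrier_mat m n :: 'a::finite mat set)"
proof -
  let ?F = "PiE ({0..<m} \<times> {0..<n}) (\<lambda>_. UNIV :: 'a set)"
  have "carrier_mat m n \<subseteq> mat m n ` ?F"
  proof
    fix A :: "'a mat" assume A: "A \<in> carrier_mat m n"
    let ?f = "restrict (\<lambda>ij. A $$ ij) ({0..<m} \<times> {0..<n})"
    have "A = mat m n ?f"
      using A by (intro eq_matI) simp_all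
    moreover have "?f \<in> ?F" by simp
    ultimately show "A \<in> mat m n ` ?F" by (rule image_eqI)
  qed
  moreover have "finite ?F" by (intro finite_PiE) simp_all
  ultimately show ?thesis by (rule finite_surj[rotated])
qed

lemma set_uniform_mat: "set_pmf (uniform_mat m n :: 'a::{field,finite} mat pmf) = carrier_mat m n"
proof -
  have "carrier_mat m n \<noteq> ({} :: 'a mat set)" using zero_carrier_mat by blast
  then show ?thesis unfolding uniform_mat_def by (simp add: finite_carrier_mat)
qed

end

theory Submission
  imports Defs "HOL-Library.Sublist"
begin

text \<open>Let \<open>N\<close> be a representable excluded minor of the least rank \<open>k\<close>, represented by a matrix \<open>B\<close>
  with exactly \<open>k\<close> rows, and expose the columns of a uniform \<open>m \<times> n\<close> matrix one at a time. While
  \<open>m > k\<close>, a nonzero first column may be contracted, which leaves a uniform \<open>(m - 1) \<times> (n - 1)\<close>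
  matrix, and a zero first column (probability \<open>q\<^sup>-\<^sup>m\<close>) may be deleted. Hence the probability
  \<open>P m n\<close> of lying in the class satisfies
  \<open>P m n \<le> (1 - q\<^sup>-\<^sup>m) P (m - 1) (n - 1) + q\<^sup>-\<^sup>m P m (n - 1)\<close>. For \<open>m = k\<close> the columns of \<open>B\<close>
  occur in order among the columns except with exponentially small probability. By induction
  \<open>P m (m + d) \<le> C (2 - q\<^sup>-\<^sup>m) r\<^sup>d\<close> for all \<open>m \<ge> k\<close>, with some \<open>r < 1\<close>.\<close>

unbundle no vec_syntax

section \<open>Matroids of vector families\<close>

text \<open>Independence is stated for indexed families, so a repeated vector is dependent with no
  injectivity clause. Vectors are functions of which only the coordinates below \<open>m\<close>
  count.\<close>

definition indep_fam :: "nat \<Rightarrow> ('e \<Rightarrow> nat \<Rightarrow> 'a::field) \<Rightarrow> 'e set \<Rightarrow> bool" where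
  "indep_fam m w S \<longleftrightarrow>
     (\<forall>c. (\<forall>i<m. (\<Sum>j\<in>S. c j * w j i) = 0) \<longrightarrow> (\<forall>j\<in>S. c j = 0))"

text \<open>An arbitrary index set \<open>E\<close> lets minors keep their labels; renumbering is
  postponed until a matrix is wanted.\<close>

definition fam_matroid :: "nat \<Rightarrow> 'e set \<Rightarrow> ('e \<Rightarrow> nat \<Rightarrow> 'a::field) \<Rightarrow> 'e indep_sys" where
  "fam_matroid m E w = \<lparr>ground = E, indeps = {S. S \<subseteq> E \<and> indep_fam m w S}\<rparr>"

lemma indep_famD:
  "indep_fam m w S \<Longrightarrow> (\<And>i. i < m \<Longrightarrow> (\<Sum>j\<in>S. c j * w j i) = 0) \<Longrightarrow> j \<in> S \<Longrightarrow> c j = 0"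
  unfolding indep_fam_def by blast

lemma indep_fam_image:
  assumes "inj_on f S"
  shows "indep_fam m w (f ` S) \<longleftrightarrow> indep_fam m (w \<circ> f) S"
proof
  assume L: "indep_fam m w (f ` S)"
  show "indep_fam m (w \<circ> f) S"
    unfolding indep_fam_def
  proof (intro allI impI ballI)
    fix c j
    assume c: "\<forall>i<m. (\<Sum>j\<in>S. c j * (w \<circ> f) j i) = 0" and j: "j \<in> S"
    have "c (the_inv_into S f (f j)) = 0"
      using c j
      by (intro indep_famD[OF L, where c = "\<lambda>x. c (the_inv_into S f x)" and j = "f j"])
         (simp_all add: sum.reindex[OF assms] the_inv_into_f_f[OF assms])
    then show "c j = 0" by (simp add: the_inv_into_f_f[OF assms j])
  qed
next
  assume R: "indep_fam m (w \<circ> f) S"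
  show "indep_fam m w (f ` S)"
    unfolding indep_fam_def
  proof (intro allI impI ballI)
    fix c j
    assume c: "\<forall>i<m. (\<Sum>j\<in>f ` S. c j * w j i) = 0" and "j \<in> f ` S"
    then obtain s where "s \<in> S" "j = f s" by blast
    then show "c j = 0"
      using indep_famD[OF R, of "c \<circ> f" s] c by (simp add: sum.reindex[OF assms])
  qed
qed

lemma indep_fam_cong:
  assumes "\<And>j i. j \<in> S \<Longrightarrow> i < m \<Longrightarrow> w j i = w' j i"
  shows "indep_fam m w S \<longleftrightarrow> indep_fam m w' S"
proof -
  have "(\<Sum>j\<in>S. c j * w j i) = (\<Sum>j\<in>S. c j * w' j i)" if "i < m" for c i
    using assms that by (intro sum.cong) auto
  then show ?thesis unfolding indep_fam_def by simp
qed

lemma fam_matroid_cong: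
  assumes "\<And>j i. j \<in> E \<Longrightarrow> i < m \<Longrightarrow> w j i = w' j i"
  shows "fam_matroid m E w = fam_matroid m E w'"
proof -
  have "indep_fam m w S = indep_fam m w' S" if "S \<subseteq> E" for S
    using assms that by (intro indep_fam_cong) auto
  then show ?thesis unfolding fam_matroid_def by auto
qed

text \<open>A relation on \<open>T\<close> becomes a relation on \<open>S\<close> when the other
  indices get coefficient 0.\<close>

lemma indep_fam_mono:
  assumes "indep_fam m w S" "T \<subseteq> S" "finite S"
  shows "indep_fam m w T"
  unfolding indep_fam_def
proof (intro allI impI ballI)
  fix c j
  assume c: "\<forall>i<m. (\<Sum>j\<in>T. c j * w j i) = 0" and j: "j \<in> T"
  have "(\<Sum>j\<in>S. (if j \<in> T then c j else 0) * w j i) = (\<Sum>j\<in>T. c j * w j i)" for i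
    using assms(2,3) by (intro sum.mono_neutral_cong_right) auto
  then have "(if j \<in> T then c j else 0) = 0"
    using c j assms(2)
    by (intro indep_famD[OF assms(1), where c = "\<lambda>j. if j \<in> T then c j else 0" and j = j]) auto
  then show "c j = 0" using j by simp
qed

text \<open>On an index set where \<open>col A\<close> is injective, a linear combination of the set
  of columns is a sum over indices. Independence of the family forces that injectivity.\<close>

lemma col_matroid_eq_fam:
  fixes A :: "'a::field mat"
  shows "col_matroid A = fam_matroid (dim_row A) {0..<dim_col A} (\<lambda>j i. A $$ (i, j))"
proof -
  interpret vec_space "TYPE('a)" "dim_row A" .
  have "inj_on (col A) S \<and> lin_indpt (col A ` S) \<longleftrightarrow> indep_fam (dim_row A) (\<lambda>j i. A $$ (i, j)) S"
    if S: "S \<subseteq> {0..<dim_col A}" for S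
  proof -
    have fin: "finite S" using S finite_subset by blast
    have car: "col A ` S \<subseteq> carrier_vec (dim_row A)" by auto
    have ent: "A $$ (i, j) = col A j $ i" if "i < dim_row A" "j \<in> S" for i j
      using that S by (simp add: subset_eq)
    have eq: "lincomb a (col A ` S) = 0\<^sub>v (dim_row A) \<longleftrightarrow>
        (\<forall>i<dim_row A. (\<Sum>j\<in>S. a (col A j) * A $$ (i, j)) = 0)" if inj: "inj_on (col A) S" for a
    proof -
      have "lincomb a (col A ` S) $ i = (\<Sum>j\<in>S. a (col A j) * A $$ (i, j))" if "i < dim_row A" for i
        using that by (simp add: lincomb_index[OF _ car] sum.reindex[OF inj] ent)
      moreover have "lincomb a (col A ` S) \<in> carrier_vec (dim_row A)"
        by (rule lincomb_closed[OF car])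
      then have "dim_vec (lincomb a (col A ` S)) = dim_row A" by auto
      ultimately show ?thesis by (auto simp: vec_eq_iff)
    qed
    show ?thesis
    proof
      assume L: "inj_on (col A) S \<and> lin_indpt (col A ` S)"
      then have inj: "inj_on (col A) S" by simp
      show "indep_fam (dim_row A) (\<lambda>j i. A $$ (i, j)) S"
        unfolding indep_fam_def
      proof (intro allI impI ballI)
        fix c j
        assume c: "\<forall>i<dim_row A. (\<Sum>j\<in>S. c j * A $$ (i, j)) = 0" and j: "j \<in> S"
        \<comment> \<open>Coefficients indexed by \<open>S\<close> are carried over to the column
          vectors themselves.\<close>
        let ?a = "\<lambda>x. c (the_inv_into S (col A) x)"
        have "lincomb ?a (col A ` S) = 0\<^sub>v (dim_row A)"
          using c by (simp add: eq[OF inj] the_inv_into_f_f[OF inj])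
        then have "?a \<in> col A ` S \<rightarrow> {0}"
          using not_lindepD[of "col A ` S" "col A ` S" ?a] L fin by (simp add: class_ring_simps)
        then have "?a (col A j) = 0" using j by blast
        then show "c j = 0" by (simp add: the_inv_into_f_f[OF inj j])
      qed
    next
      assume R: "indep_fam (dim_row A) (\<lambda>j i. A $$ (i, j)) S"
      have inj: "inj_on (col A) S"
      proof (rule inj_onI, rule ccontr)
        fix x y assume xy: "x \<in> S" "y \<in> S" "col A x = col A y" "x \<noteq> y"
        \<comment> \<open>Two equal columns satisfy a nontrivial relation with coefficients 1 and
          -1.\<close>
        let ?c = "\<lambda>j. if j = x then 1 else if j = y then - 1 else (0::'a)"
        have "(\<Sum>j\<in>S. ?c j * A $$ (i, j)) = 0" if i: "i < dim_row A" for i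
        proof -
          have "(\<Sum>j\<in>S. ?c j * A $$ (i, j)) = (\<Sum>j\<in>{x, y}. ?c j * A $$ (i, j))"
            using xy fin by (intro sum.mono_neutral_right) auto
          then show ?thesis using xy ent[OF i xy(1)] ent[OF i xy(2)] by simp
        qed
        then have "?c x = 0" using xy(1) by (rule indep_famD[OF R, where c = ?c])
        then show False by simp
      qed
      moreover have "lin_indpt (col A ` S)"
      proof (rule finite_lin_indpt2)
        show "finite (col A ` S)" using fin by simp
        show "col A ` S \<subseteq> carrier_vec (dim_row A)" by (fact car)
        fix a assume "lincomb a (col A ` S) = 0\<^sub>v (dim_row A)"
        then have "\<forall>i<dim_row A. (\<Sum>j\<in>S. a (col A j) * A $$ (i, j)) = 0"
          by (simp add: eq[OF inj])
        then show "\<forall>v\<in>col A ` S. a v = 0"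
          using indep_famD[OF R, of "a \<circ> col A"] by (auto simp: class_ring_simps)
      qed
      ultimately show "inj_on (col A) S \<and> lin_indpt (col A ` S)" by simp
    qed
  qed
  then show ?thesis unfolding col_matroid_def fam_matroid_def by auto
qed

lemma fam_matroid_eq_col:
  "fam_matroid m {0..<n} w = col_matroid (mat m n (\<lambda>(i, j). w j i))"
  unfolding col_matroid_eq_fam by (auto intro!: fam_matroid_cong)

lemma fam_matroid_simps [simp]:
  "ground (fam_matroid m E w) = E"
  "S \<in> indeps (fam_matroid m E w) \<longleftrightarrow> S \<subseteq> E \<and> indep_fam m w S"
  by (simp_all add: fam_matroid_def)

lemma isomorphic_fam:
  assumes "matroid M" "matroid (fam_matroid m E w)" "bij_betw f (ground M) E"
    and "M = fam_matroid m (ground M) (w \<circ> f)"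
  shows "isomorphic M (fam_matroid m E w)"
proof -
  have "I \<in> indeps M \<longleftrightarrow> f ` I \<in> indeps (fam_matroid m E w)" if "I \<subseteq> ground M" for I
  proof -
    have "inj_on f I" using assms(3) that inj_on_subset by (auto simp: bij_betw_def)
    moreover have "f ` I \<subseteq> E" using assms(3) that by (auto simp: bij_betw_def)
    ultimately show ?thesis using that by (subst assms(4)) (simp add: indep_fam_image)
  qed
  then show ?thesis unfolding isomorphic_def using assms(1-3) by auto
qed

text \<open>Pulling the columns back along the isomorphism represents \<open>M\<close> on its own
  ground set, where deletion and contraction can be computed directly. Conversely, numbering the
  ground set yields a matrix.\<close>

lemma representable_iff_fam:
  "representable TYPE('a::field) M \<longleftrightarrow>
     matroid M \<and> (\<exists>m (w :: _ \<Rightarrow> nat \<Rightarrow> 'a). M = fam_matroid m (ground M) w)"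
proof
  assume "representable TYPE('a) M"
  then obtain A :: "'a mat" and f where M: "matroid M"
    and f: "bij_betw f (ground M) (ground (col_matroid A))"
    and I: "\<And>I. I \<subseteq> ground M \<Longrightarrow> I \<in> indeps M \<longleftrightarrow> f ` I \<in> indeps (col_matroid A)"
    unfolding representable_def isomorphic_def by blast
  let ?w = "\<lambda>j i. A $$ (i, f j)"
  have "I \<in> indeps M \<longleftrightarrow> I \<subseteq> ground M \<and> indep_fam (dim_row A) ?w I" for I
  proof (cases "I \<subseteq> ground M")
    case True
    have "inj_on f I" using f True inj_on_subset by (auto simp: bij_betw_def)
    then have "indep_fam (dim_row A) (\<lambda>j i. A $$ (i, j)) (f ` I) = indep_fam (dim_row A) ?w I"
      by (simp add: indep_fam_image comp_def)
    moreover have "f ` I \<subseteq> ground (col_matroid A)" using f True by (auto simp: bij_betw_def)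
    ultimately show ?thesis using I[OF True] True by (simp add: col_matroid_eq_fam)
  next
    case False
    then show ?thesis using matroidD(2)[OF M] by blast
  qed
  then have "M = fam_matroid (dim_row A) (ground M) ?w"
    by (intro indep_sys.equality) auto
  then show "matroid M \<and> (\<exists>m (w :: _ \<Rightarrow> nat \<Rightarrow> 'a). M = fam_matroid m (ground M) w)"
    using M by blast
next
  assume "matroid M \<and> (\<exists>m (w :: _ \<Rightarrow> nat \<Rightarrow> 'a). M = fam_matroid m (ground M) w)"
  then obtain m and w :: "_ \<Rightarrow> nat \<Rightarrow> 'a" where M: "matroid M" "M = fam_matroid m (ground M) w"
    by blast
  let ?n = "card (ground M)"
  obtain g where g: "bij_betw g (ground M) {0..<?n}"
    using ex_bij_betw_finite_nat[OF matroidD(1)[OF M(1)]] by blast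
  let ?w = "w \<circ> the_inv_into (ground M) g"
  have "M = fam_matroid m (ground M) (?w \<circ> g)"
    using g by (subst M(2)) (auto intro!: fam_matroid_cong simp: the_inv_into_f_f bij_betw_def)
  then have "isomorphic M (fam_matroid m {0..<?n} ?w)"
    using M(1) g by (intro isomorphic_fam) (simp_all add: fam_matroid_eq_col matroid_col_matroid)
  then show "representable TYPE('a) M"
    unfolding representable_def fam_matroid_eq_col by blast
qed

section \<open>Contraction as a quotient by a line\<close>

text \<open>Pivoting on a nonzero entry \<open>v p\<close> realises the quotient of the \<open>Suc m\<close>-dimensional space by
  the line through \<open>v\<close>: subtract the multiple of \<open>v\<close> that clears coordinate \<open>p\<close>, then drop it.\<close>

definition skip :: "nat \<Rightarrow> nat \<Rightarrow> nat" where
  "skip p i = (if i < p then i else Suc i)"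

definition quot_line :: "nat \<Rightarrow> (nat \<Rightarrow> 'a::field) \<Rightarrow> (nat \<Rightarrow> 'a) \<Rightarrow> nat \<Rightarrow> 'a" where
  "quot_line p v x i = x (skip p i) - x p / v p * v (skip p i)"

lemma skip_cases:
  assumes "j < Suc m" "p < Suc m"
  obtains "j = p" | i where "i < m" "j = skip p i"
proof (cases "j = p")
  case False
  then have "(if j < p then j else j - 1) < m \<and> j = skip p (if j < p then j else j - 1)"
    using assms by (auto simp: skip_def)
  then show ?thesis using that by blast
qed (use that in blast)

lemma skip_less: "i < m \<Longrightarrow> skip p i < Suc m"
  by (auto simp: skip_def)

text \<open>A relation among the images modulo the line of \<open>w e\<close> is a relation among
  the original vectors and \<open>w e\<close>; the coefficient of \<open>w e\<close> is determined
  by coordinate \<open>p\<close>.\<close>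

lemma indep_fam_quot_line:
  assumes "p < Suc m" "w e p \<noteq> 0" "e \<notin> I" "finite I"
  shows "indep_fam m (quot_line p (w e) \<circ> w) I \<longleftrightarrow> indep_fam (Suc m) w (insert e I)"
proof -
  have sum_quot: "(\<Sum>j\<in>I. c j * quot_line p (w e) (w j) i) =
      (\<Sum>j\<in>I. c j * w j (skip p i)) - (\<Sum>j\<in>I. c j * w j p) / w e p * w e (skip p i)" for c i
  proof -
    have "(\<Sum>j\<in>I. c j * quot_line p (w e) (w j) i) =
        (\<Sum>j\<in>I. c j * w j (skip p i) - c j * w j p * (w e (skip p i) / w e p))"
      by (simp add: quot_line_def algebra_simps)
    then show ?thesis by (simp only: sum_subtractf flip: sum_distrib_right) simp
  qed
  show ?thesis
    unfolding comp_def
  proof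
    assume L: "indep_fam m (\<lambda>j. quot_line p (w e) (w j)) I"
    show "indep_fam (Suc m) w (insert e I)"
      unfolding indep_fam_def
    proof (intro allI impI)
      fix c assume c: "\<forall>i<Suc m. (\<Sum>j\<in>insert e I. c j * w j i) = 0"
      have s: "(\<Sum>j\<in>I. c j * w j i) = - (c e * w e i)" if "i < Suc m" for i
        using c that assms(3,4) by (simp add: eq_neg_iff_add_eq_0 add.commute)
      \<comment> \<open>Inserting \<open>s\<close> into \<open>sum_quot\<close>, once at
        \<open>skip p i\<close> and once at \<open>p\<close>, makes the two terms cancel.\<close>
      have "(\<Sum>j\<in>I. c j * quot_line p (w e) (w j) i) = 0" if "i < m" for i
        using that assms(1,2) by (simp add: sum_quot s skip_less)
      then have I: "c j = 0" if "j \<in> I" for j using indep_famD[OF L] that by blast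
      have "c e * w e p = - (\<Sum>j\<in>I. c j * w j p)" using s[OF assms(1)] by simp
      then have "c e = 0" using I assms(2) by simp
      then show "\<forall>j\<in>insert e I. c j = 0" using I by blast
    qed
  next
    assume R: "indep_fam (Suc m) w (insert e I)"
    show "indep_fam m (\<lambda>j. quot_line p (w e) (w j)) I"
      unfolding indep_fam_def
    proof (intro allI impI ballI)
      fix c j
      assume c: "\<forall>i<m. (\<Sum>j\<in>I. c j * quot_line p (w e) (w j) i) = 0" and j: "j \<in> I"
      let ?t = "(\<Sum>j\<in>I. c j * w j p) / w e p"
      \<comment> \<open>This coefficient of \<open>w e\<close> is the one that makes coordinate
        \<open>p\<close> vanish; the hypothesis on the quotients handles the other
        coordinates.\<close>
      let ?c = "c(e := - ?t)"
      have "(\<Sum>j\<in>insert e I. ?c j * w j i) = 0" if i: "i < Suc m" for i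
      proof -
        have "(\<Sum>j\<in>I. ?c j * w j i) = (\<Sum>j\<in>I. c j * w j i)"
          using assms(3) by (intro sum.cong) auto
        then have eq: "(\<Sum>j\<in>insert e I. ?c j * w j i) = (\<Sum>j\<in>I. c j * w j i) - ?t * w e i"
          using assms(3,4) by simp
        from i assms(1) show ?thesis
        proof (cases rule: skip_cases)
          case 1
          then show ?thesis using eq assms(2) by simp
        next
          case (2 l)
          then show ?thesis using eq c sum_quot by simp
        qed
      qed
      then have "?c j = 0" using j by (intro indep_famD[OF R, where c = ?c and j = j]) auto
      then show "c j = 0" using j assms(3) by (auto split: if_splits)
    qed
  qed
qed

lemma indep_fam_singleton: "indep_fam m w {e} \<longleftrightarrow> (\<exists>p<m. w e p \<noteq> 0)"
proof
  assume "indep_fam m w {e}"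
  from indep_famD[OF this, of "\<lambda>_. 1" e] show "\<exists>p<m. w e p \<noteq> 0" by auto
qed (auto simp: indep_fam_def)

lemma del_elem_fam: "del_elem (fam_matroid m E w) e = fam_matroid m (E - {e}) w"
  by (auto simp: del_elem_def fam_matroid_def)

text \<open>The nonzero entry makes \<open>e\<close> a non-loop, so contraction is the quotient by
  the line of \<open>w e\<close> and uses up one row.\<close>

lemma contract_elem_fam:
  assumes "finite E" "e \<in> E" "p < Suc m" "w e p \<noteq> 0"
  shows "contract_elem (fam_matroid (Suc m) E w) e = fam_matroid m (E - {e}) (quot_line p (w e) \<circ> w)"
proof -
  have "{e} \<in> indeps (fam_matroid (Suc m) E w)"
    using assms by (auto simp: indep_fam_singleton)
  moreover have "(e \<notin> I \<and> insert e I \<subseteq> E \<and> indep_fam (Suc m) w (insert e I)) \<longleftrightarrow>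
      (I \<subseteq> E - {e} \<and> indep_fam m (quot_line p (w e) \<circ> w) I)" for I
    using indep_fam_quot_line[of p m w e I] assms finite_subset[of I E] by blast
  ultimately show ?thesis
    by (simp add: contract_elem_def) (simp add: fam_matroid_def)
qed

lemma contract_elem_fam_loop:
  assumes "\<not> indep_fam m w {e}"
  shows "contract_elem (fam_matroid m E w) e = fam_matroid m (E - {e}) w"
  using assms by (simp add: contract_elem_def del_elem_fam)

section \<open>Minors of representable matroids and the existence of excluded minors\<close>

lemma representable_elem_minor:
  assumes "representable TYPE('a::field) M" "elem_minor M N"
  shows "representable TYPE('a) N" and "card (ground N) < card (ground M)"
proof -
  obtain m E and w :: "_ \<Rightarrow> nat \<Rightarrow> 'a" where M: "matroid M" and eq: "M = fam_matroid m E w"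
    using assms(1) unfolding representable_iff_fam by blast
  obtain e where e: "e \<in> E" and N: "N = del_elem M e \<or> N = contract_elem M e"
    using assms(2) unfolding elem_minor_def eq by auto
  have fin: "finite E" using matroidD(1)[OF M] by (simp add: eq)
  have "matroid N" using N matroid_del_elem[OF M] matroid_contract_elem[OF M] by auto
  have "\<exists>m' (w' :: _ \<Rightarrow> nat \<Rightarrow> 'a). N = fam_matroid m' (E - {e}) w'"
  \<comment> \<open>Contracting a loop is deleting it, so the family stays the same in the first
    case.\<close>
  proof (cases "N = del_elem M e \<or> \<not> indep_fam m w {e}")
    case True
    then have "N = fam_matroid m (E - {e}) w"
      using N contract_elem_fam_loop[of m w e E] by (auto simp: eq del_elem_fam)
    then show ?thesis by blast
  next
    case False
    then obtain p where p: "p < m" "w e p \<noteq> 0" by (auto simp: indep_fam_singleton)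
    then obtain m' where m': "m = Suc m'" by (cases m) auto
    have "N = contract_elem (fam_matroid (Suc m') E w) e" using False N eq m' by simp
    then show ?thesis using contract_elem_fam[OF fin e, of p m' w] p m' by blast
  qed
  then obtain m' and w' :: "_ \<Rightarrow> nat \<Rightarrow> 'a" where N': "N = fam_matroid m' (E - {e}) w'" by blast
  then have "N = fam_matroid m' (ground N) w'" by (simp add: N')
  then show "representable TYPE('a) N" unfolding representable_iff_fam using \<open>matroid N\<close> by blast
  show "card (ground N) < card (ground M)" using card_Diff1_less[OF fin e] by (simp only: N' eq fam_matroid_simps)
qed

lemma representable_tranclp_elem_minor:
  assumes "elem_minor\<^sup>+\<^sup>+ M N" "representable TYPE('a::field) M"
  shows "representable TYPE('a) N \<and> card (ground N) < card (ground M)"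
  using assms by induction (auto dest: representable_elem_minor intro: less_trans)

text \<open>A representable non-member with the fewest elements works: its proper minors are
  representable and smaller, hence members.\<close>

lemma representable_excluded_minor_exists:
  assumes "minor_closed \<M>" "proper_class TYPE('a::field) \<M>"
  shows "\<exists>N. representable TYPE('a) N \<and> excluded_minor \<M> N"
proof -
  let ?P = "\<lambda>N. representable TYPE('a) N \<and> N \<notin> \<M>"
  obtain N where N: "?P N" and min: "\<And>N'. ?P N' \<Longrightarrow> card (ground N) \<le> card (ground N')"
    using assms(2) ex_has_least_nat[of ?P _ "\<lambda>N. card (ground N)"] unfolding proper_class_def by metis
  have "N' \<in> \<M>" if minor: "is_proper_minor N' N" for N'
  proof -
    obtain N'' where N'': "elem_minor\<^sup>+\<^sup>+ N N''" "isomorphic N' N''"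
      using minor unfolding is_proper_minor_def by blast
    have "N'' \<in> \<M>" using representable_tranclp_elem_minor[OF N''(1)] N min[of N''] by fastforce
    \<comment> \<open>Zero removals suffice: minors are taken up to isomorphism, so minor-closedness
      transfers membership to \<open>N'\<close>.\<close>
    moreover have "is_minor N' N''" unfolding is_minor_def using N''(2) by blast
    ultimately show ?thesis using assms(1) unfolding minor_closed_def by blast
  qed
  then have "excluded_minor \<M> N" using N by (simp add: excluded_minor_def representable_iff_fam)
  then show ?thesis using N by blast
qed

section \<open>Reducing the number of rows to the rank\<close>

text \<open>Take a largest independent set containing \<open>J\<close>. If it were smaller than
  \<open>I\<close>, augmentation from \<open>I\<close> would enlarge it.\<close>

lemma extend_indep:
  assumes M: "matroid M" and J: "J \<in> indeps M" and I: "I \<in> indeps M"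
  shows "\<exists>J'\<in>indeps M. J \<subseteq> J' \<and> card I \<le> card J'"
proof -
  let ?P = "\<lambda>K. K \<in> indeps M \<and> J \<subseteq> K"
  have bound: "\<forall>K. ?P K \<longrightarrow> card K < Suc (card (ground M))"
    unfolding less_Suc_eq_le by (intro allI impI card_mono matroidD(1)[OF M] matroidD(2)[OF M]) simp
  then obtain K where K: "?P K" and max: "\<And>L. ?P L \<Longrightarrow> card L \<le> card K"
    using ex_has_greatest_nat[of ?P J card, OF _ bound] J by auto
  have "\<not> card K < card I"
  proof
    assume "card K < card I"
    then obtain e where e: "e \<in> I - K" "insert e K \<in> indeps M" using matroidD(5)[OF M _ I] K by blast
    then have "card (insert e K) \<le> card K" using K by (intro max) auto
    then show False using e matroid_finite_indep[OF M] K by simp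
  qed
  then show ?thesis using K by (intro bexI[of _ K]) auto
qed

lemma indep_card_le_rank:
  assumes "matroid M" "I \<in> indeps M"
  shows "card I \<le> matroid_rank M"
proof -
  have "finite (indeps M)"
    using matroidD(1,2)[OF assms(1)] finite_subset[of "indeps M" "Pow (ground M)"] by auto
  then show ?thesis unfolding matroid_rank_def using assms(2) by (intro Max_ge) auto
qed

lemma rank_attained:
  assumes "matroid M"
  obtains I where "I \<in> indeps M" "card I = matroid_rank M"
proof -
  have "finite (indeps M)"
    using matroidD(1,2)[OF assms(1)] finite_subset[of "indeps M" "Pow (ground M)"] by auto
  moreover have "indeps M \<noteq> {}" using matroidD(3)[OF assms] by blast
  ultimately have "matroid_rank M \<in> card ` indeps M"
    unfolding matroid_rank_def by (intro Max_in) auto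
  then show ?thesis using that by auto
qed

lemma rank_isomorphic:
  assumes "isomorphic M N"
  shows "matroid_rank M = matroid_rank N"
proof -
  obtain f where M: "matroid M" and N: "matroid N" and f: "bij_betw f (ground M) (ground N)"
    and iff: "\<And>I. I \<subseteq> ground M \<Longrightarrow> I \<in> indeps M \<longleftrightarrow> f ` I \<in> indeps N"
    using assms unfolding isomorphic_def by blast
  have inj: "inj_on f I" if "I \<subseteq> ground M" for I
    using f that inj_on_subset by (auto simp: bij_betw_def)
  have "card ` indeps M = card ` indeps N"
  proof (intro equalityI subsetI)
    fix r assume "r \<in> card ` indeps M"
    then obtain I where I: "I \<in> indeps M" "r = card I" by blast
    then show "r \<in> card ` indeps N"
      using iff[of I] matroidD(2)[OF M I(1)] by (intro image_eqI[of _ _ "f ` I"]) (auto simp: card_image inj)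
  next
    fix r assume "r \<in> card ` indeps N"
    then obtain I where I: "I \<in> indeps N" "r = card I" by blast
    obtain J where J: "J \<subseteq> ground M" "I = f ` J"
      using matroidD(2)[OF N I(1)] bij_betw_imp_surj_on[OF f] subset_imageE by metis
    then show "r \<in> card ` indeps M"
      using iff[of J] I by (intro image_eqI[of _ _ J]) (auto simp: card_image inj)
  qed
  then show ?thesis by (simp add: matroid_rank_def)
qed

section \<open>Changing the number of rows\<close>

lemma sum_unit_vectors:
  fixes c :: "nat \<Rightarrow> 'a::field"
  assumes "i < m"
  shows "(\<Sum>j\<in>{n..<n + m}. c j * (if i = j - n then 1 else 0)) = c (n + i)"
proof -
  have "(\<Sum>j\<in>{n..<n + m}. c j * (if i = j - n then 1 else 0)) =
      (\<Sum>j\<in>{n + i}. c j * (if i = j - n then 1 else 0))"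
    using assms by (intro sum.mono_neutral_right) auto
  then show ?thesis by simp
qed

text \<open>If the rank is less than the number of rows, some unit vector lies outside the column
  space; quotienting by it removes a row without changing the matroid.\<close>

lemma drop_row:
  fixes w :: "nat \<Rightarrow> nat \<Rightarrow> 'a::field"
  assumes rank: "matroid_rank (fam_matroid (Suc m) {0..<n} w) < Suc m"
  shows "\<exists>w' :: nat \<Rightarrow> nat \<Rightarrow> 'a. fam_matroid m {0..<n} w' = fam_matroid (Suc m) {0..<n} w"
proof -
  let ?M = "fam_matroid (Suc m) {0..<n} w"
  \<comment> \<open>The columns are followed by all \<open>Suc m\<close> unit vectors, the
    \<open>i\<close>-th one at index \<open>n + i\<close>.\<close>
  define u where "u j i = (if j < n then w j i else if i = j - n then 1 else 0)" for j i
  let ?U = "fam_matroid (Suc m) {0..<n + Suc m} u"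
  have M: "matroid ?M" and U: "matroid ?U" by (simp_all add: fam_matroid_eq_col matroid_col_matroid)
  have eq: "indep_fam (Suc m) u S \<longleftrightarrow> indep_fam (Suc m) w S" if "S \<subseteq> {0..<n}" for S
    using that by (intro indep_fam_cong) (auto simp: u_def)
  have MU: "S \<in> indeps ?U" if "S \<in> indeps ?M" for S
    using that eq by auto
  obtain I where I: "I \<in> indeps ?M" "card I = matroid_rank ?M" using rank_attained[OF M] .
  have "indep_fam (Suc m) u {n..<n + Suc m}"
    unfolding indep_fam_def
  proof (intro allI impI ballI)
    fix c j
    assume c: "\<forall>i<Suc m. (\<Sum>j\<in>{n..<n + Suc m}. c j * u j i) = 0" and j: "j \<in> {n..<n + Suc m}"
    have i: "j - n < Suc m" using j by auto
    have "(\<Sum>l\<in>{n..<n + Suc m}. c l * u l (j - n)) =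
        (\<Sum>l\<in>{n..<n + Suc m}. c l * (if j - n = l - n then 1 else 0))"
      by (intro sum.cong) (auto simp: u_def)
    also have "\<dots> = c (n + (j - n))" by (rule sum_unit_vectors[OF i])
    finally show "c j = 0" using c i j by simp
  qed
  then have "{n..<n + Suc m} \<in> indeps ?U" by auto
  moreover have "card I < card {n..<n + Suc m}" using I(2) rank by simp
  \<comment> \<open>\<open>I\<close> is a basis of \<open>?M\<close> with fewer than
    \<open>Suc m\<close> elements, so augmentation supplies a unit vector outside its span.\<close>
  ultimately obtain e where e: "e \<in> {n..<n + Suc m} - I" and eI: "insert e I \<in> indeps ?U"
    using matroidD(5)[OF U MU[OF I(1)]] by blast
  \<comment> \<open>Adding \<open>e\<close> does not affect independence among the columns: extend
    \<open>J\<close> to a basis \<open>J'\<close> and augment \<open>J'\<close> from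
    \<open>insert e I\<close>. An element of \<open>I\<close> would enlarge the basis, so the new
    element is \<open>e\<close>.\<close>
  have iff: "indep_fam (Suc m) u (insert e J) \<longleftrightarrow> indep_fam (Suc m) w J" if J: "J \<subseteq> {0..<n}" for J
  proof
    assume "indep_fam (Suc m) u (insert e J)"
    then show "indep_fam (Suc m) w J"
      using indep_fam_mono[of "Suc m" u "insert e J" J] J finite_subset eq[OF J] by blast
  next
    assume "indep_fam (Suc m) w J"
    then have "J \<in> indeps ?M" using J by simp
    then obtain J' where J': "J' \<in> indeps ?M" "J \<subseteq> J'" "card I \<le> card J'"
      using extend_indep[OF M _ I(1)] by blast
    then have card: "card J' = card I" using indep_card_le_rank[OF M J'(1)] I(2) by simp
    have "finite I" using matroid_finite_indep[OF M I(1)] .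
    then have "card J' < card (insert e I)" using card e by simp
    then obtain x where x: "x \<in> insert e I - J'" "insert x J' \<in> indeps ?U"
      using matroidD(5)[OF U MU[OF J'(1)] eI] by blast
    have "x = e"
    proof (rule ccontr)
      assume "x \<noteq> e"
      then have "x \<in> {0..<n}" using x(1) matroidD(2)[OF M I(1)] by auto
      then have "insert x J' \<in> indeps ?M" using x(2) J'(1) eq[of "insert x J'"] by auto
      then have "card (insert x J') \<le> card I" using indep_card_le_rank[OF M] I(2) by simp
      then show False using x(1) card matroid_finite_indep[OF M J'(1)] by simp
    qed
    then have "indep_fam (Suc m) u (insert e J')" "finite (insert e J')"
      using x matroid_finite_indep[OF U x(2)] by auto
    then show "indep_fam (Suc m) u (insert e J)"
      using indep_fam_mono J'(2) by (metis insert_mono)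
  qed
  \<comment> \<open>The pivot is the row in which the unit vector with index \<open>e\<close> has
    its entry 1.\<close>
  have p: "e - n < Suc m" "u e (e - n) \<noteq> 0" using e by (auto simp: u_def)
  have "indep_fam m (quot_line (e - n) (u e) \<circ> u) J \<longleftrightarrow> indep_fam (Suc m) w J"
    if J: "J \<subseteq> {0..<n}" for J
  proof -
    have "e \<notin> J" "finite J" using e J finite_subset[OF J] by auto
    then show ?thesis using indep_fam_quot_line[of "e - n" m u e J] p iff[OF J] by simp
  qed
  then show ?thesis
    by (intro exI[of _ "quot_line (e - n) (u e) \<circ> u"]) (auto simp: fam_matroid_def)
qed

lemma add_zero_row:
  "fam_matroid (Suc m) E (\<lambda>j i. if i < m then w j i else 0) = fam_matroid m E w"
  by (auto simp: fam_matroid_def indep_fam_def less_Suc_eq)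

text \<open>Zero rows are added while there are too few; otherwise \<open>drop_row\<close> applies
  repeatedly, since the rank stays at most \<open>k\<close>.\<close>

lemma fam_matroid_rows:
  fixes w :: "nat \<Rightarrow> nat \<Rightarrow> 'a::field"
  assumes "matroid_rank (fam_matroid m {0..<n} w) \<le> k"
  shows "\<exists>w' :: nat \<Rightarrow> nat \<Rightarrow> 'a. fam_matroid k {0..<n} w' = fam_matroid m {0..<n} w"
proof (cases "m \<le> k")
  case True
  then show ?thesis
  proof (induction k rule: dec_induct)
    case (step k)
    then show ?case using add_zero_row by metis
  qed blast
next
  case False
  then have "k \<le> m" by simp
  then show ?thesis
    using assms
  proof (induction m arbitrary: w rule: dec_induct)
    case (step m)
    then obtain w' :: "nat \<Rightarrow> nat \<Rightarrow> 'a" where w': "fam_matroid m {0..<n} w' = fam_matroid (Suc m) {0..<n} w"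
      using drop_row[of m n w] by auto
    then show ?case using step.IH[of w'] step.prems by simp
  qed blast
qed

section \<open>Uniform random columns\<close>

lemma card_carrier_vec: "card (carrier_vec n :: 'a::finite vec set) = CARD('a) ^ n"
  and finite_carrier_vec: "finite (carrier_vec n :: 'a::finite vec set)"
proof -
  let ?L = "{xs :: 'a list. set xs \<subseteq> UNIV \<and> length xs = n}"
  have img: "carrier_vec n = vec_of_list ` ?L"
  proof (intro equalityI subsetI)
    fix v :: "'a vec" assume "v \<in> carrier_vec n"
    then show "v \<in> vec_of_list ` ?L"
      by (intro image_eqI[of _ _ "list_of_vec v"]) (auto simp: vec_list)
  qed (auto intro: carrier_vecI)
  have "inj_on vec_of_list ?L" by (rule inj_on_inverseI) (rule list_vec)
  then show "card (carrier_vec n :: 'a vec set) = CARD('a) ^ n"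
    by (simp only: img card_image card_lists_length_eq[OF finite])
  show "finite (carrier_vec n :: 'a vec set)"
    unfolding img by (intro finite_imageI finite_lists_length_eq) simp
qed

lemma carrier_vec_nonempty: "carrier_vec n \<noteq> ({} :: 'a::zero vec set)"
  using zero_carrier_vec by blast

definition uniform_vec :: "nat \<Rightarrow> 'a::{field,finite} vec pmf" where
  "uniform_vec m = pmf_of_set (carrier_vec m)"

lemma pair_pmf_of_set:
  assumes "finite A" "A \<noteq> {}" "finite B" "B \<noteq> {}"
  shows "pair_pmf (pmf_of_set A) (pmf_of_set B) = pmf_of_set (A \<times> B)"
proof (rule pmf_eqI)
  fix z show "pmf (pair_pmf (pmf_of_set A) (pmf_of_set B)) z = pmf (pmf_of_set (A \<times> B)) z"
    using assms by (cases z) (simp add: pmf_pair indicator_def card_cartesian_product)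
qed

lemma replicate_pmf_of_set:
  assumes "finite A" "A \<noteq> {}"
  shows "replicate_pmf n (pmf_of_set A) = pmf_of_set {xs. set xs \<subseteq> A \<and> length xs = n}"
proof (induction n)
  case 0
  have "{xs. set xs \<subseteq> A \<and> length xs = 0} = {[]}" by auto
  then show ?case by (simp add: pmf_of_set_singleton)
next
  case (Suc n)
  let ?L = "\<lambda>n. {xs. set xs \<subseteq> A \<and> length xs = n}"
  have ne: "?L n \<noteq> {}"
    using assms(2) by (auto intro!: exI[of _ "replicate n (SOME a. a \<in> A)"] some_in_eq[THEN iffD2])
  have fin: "finite (?L n)" using assms(1) by (rule finite_lists_length_eq)
  have "replicate_pmf (Suc n) (pmf_of_set A) =
      map_pmf (\<lambda>(x, xs). x # xs) (pair_pmf (pmf_of_set A) (replicate_pmf n (pmf_of_set A)))"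
    by (simp add: pair_pmf_def map_bind_pmf)
  also have "\<dots> = map_pmf (\<lambda>(x, xs). x # xs) (pmf_of_set (A \<times> ?L n))"
    unfolding Suc.IH by (simp only: pair_pmf_of_set[OF assms fin ne])
  also have "\<dots> = pmf_of_set (?L (Suc n))"
  proof (rule map_pmf_of_set_bij_betw)
    show "bij_betw (\<lambda>(x, xs). x # xs) (A \<times> ?L n) (?L (Suc n))"
      unfolding bij_betw_def
    proof
      show "(\<lambda>(x, xs). x # xs) ` (A \<times> ?L n) = ?L (Suc n)"
        by (force simp: length_Suc_conv)
    qed (auto simp: inj_on_def)
  qed (use assms fin ne in auto)
  finally show ?case .
qed

lemma map_replicate_pmf:
  "map_pmf (map f) (replicate_pmf n p) = replicate_pmf n (map_pmf f p)"
proof (induction n)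
  case (Suc n)
  have "map_pmf (map f) (replicate_pmf (Suc n) p) =
      bind_pmf p (\<lambda>x. map_pmf (Cons (f x)) (map_pmf (map f) (replicate_pmf n p)))"
    by (simp add: map_bind_pmf map_pmf_comp flip: map_pmf_def)
  then show ?case by (simp add: Suc.IH bind_map_pmf flip: map_pmf_def)
qed simp

text \<open>\<open>mat_of_cols\<close> and \<open>cols\<close> are mutually inverse between lists of
  \<open>n\<close> vectors and matrices, so a uniform matrix is a list of independent uniform
  columns.\<close>

lemma uniform_mat_eq_map:
  "uniform_mat m n = map_pmf (mat_of_cols m) (replicate_pmf n (uniform_vec m))"
proof -
  let ?L = "{vs :: 'a vec list. set vs \<subseteq> carrier_vec m \<and> length vs = n}"
  have "bij_betw (mat_of_cols m) ?L (carrier_mat m n)"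
    by (rule bij_betw_byWitness[where f' = cols]) (auto intro: subsetD[OF cols_dim])
  moreover have "finite ?L" by (rule finite_lists_length_eq[OF finite_carrier_vec])
  moreover have "replicate n (0\<^sub>v m) \<in> ?L" by auto
  ultimately have "map_pmf (mat_of_cols m) (pmf_of_set ?L) = pmf_of_set (carrier_mat m n)"
    by (intro map_pmf_of_set_bij_betw) auto
  then show ?thesis
    by (simp add: uniform_mat_def uniform_vec_def replicate_pmf_of_set finite_carrier_vec
        carrier_vec_nonempty)
qed

section \<open>Quotients of uniform vectors and conditioning on the first column\<close>

definition quot_vec :: "nat \<Rightarrow> nat \<Rightarrow> 'a::field vec \<Rightarrow> 'a vec \<Rightarrow> 'a vec" where
  "quot_vec m p v x = vec m (quot_line p (\<lambda>i. v $ i) (\<lambda>i. x $ i))"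

text \<open>Together with the coordinate \<open>x $ p\<close>, the quotient determines
  \<open>x\<close>. This gives a bijection onto pairs, and the second component of a uniform pair is
  uniform.\<close>

lemma map_quot_vec_uniform:
  fixes v :: "'a::{field,finite} vec"
  assumes p: "p < Suc m"
  shows "map_pmf (quot_vec m p v) (uniform_vec (Suc m)) = uniform_vec m"
proof -
  let ?f = "\<lambda>x. (x $ p, quot_vec m p v x)"
  let ?C = "carrier_vec (Suc m) :: 'a vec set" and ?D = "UNIV \<times> carrier_vec m :: ('a \<times> 'a vec) set"
  have inj: "inj_on ?f ?C"
  proof (rule inj_onI)
    fix x y assume xy: "x \<in> ?C" "y \<in> ?C" "?f x = ?f y"
    have "x $ j = y $ j" if j: "j < Suc m" for j
      using j p
    proof (cases rule: skip_cases)
      case (2 i)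
      \<comment> \<open>The subtracted multiple of \<open>v\<close> depends on \<open>x\<close> only
        through \<open>x $ p\<close>, so it is the same for \<open>x\<close> and
        \<open>y\<close>.\<close>
      have "quot_vec m p v x $ i = quot_vec m p v y $ i" using xy by simp
      then show ?thesis using 2 xy by (simp add: quot_vec_def quot_line_def)
    qed (use xy in simp)
    then show "x = y" using xy by (intro eq_vecI) auto
  qed
  have "?f ` ?C \<subseteq> ?D" by (auto simp: quot_vec_def)
  \<comment> \<open>Surjectivity follows by counting: both sides have
    \<open>CARD('a) ^ Suc m\<close> elements.\<close>
  moreover have "card (?f ` ?C) = card ?D"
    by (simp add: card_image[OF inj] card_carrier_vec card_cartesian_product)
  moreover have "finite ?D" by (simp add: finite_carrier_vec)
  ultimately have "?f ` ?C = ?D" by (intro card_subset_eq)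
  then have bij: "bij_betw ?f ?C ?D" using inj by (simp add: bij_betw_def)
  have "map_pmf (quot_vec m p v) (uniform_vec (Suc m)) = map_pmf snd (map_pmf ?f (pmf_of_set ?C))"
    by (simp add: uniform_vec_def map_pmf_comp)
  also have "map_pmf ?f (pmf_of_set ?C) = pmf_of_set ?D"
    by (rule map_pmf_of_set_bij_betw[OF bij carrier_vec_nonempty finite_carrier_vec])
  also have "\<dots> = pair_pmf (pmf_of_set UNIV) (uniform_vec m)"
    by (simp add: uniform_vec_def pair_pmf_of_set finite_carrier_vec carrier_vec_nonempty)
  also have "map_pmf snd \<dots> = uniform_vec m" by (rule map_snd_pair_pmf)
  finally show ?thesis .
qed

text \<open>Conditions on the first entry, separating one special value from all others. The special
  value is later the zero column, or the next column to be matched.\<close>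

lemma prob_replicate_Suc_le:
  assumes A: "finite A" and v0: "v0 \<in> A"
    and a: "measure_pmf.prob (replicate_pmf n (pmf_of_set A)) {vs. v0 # vs \<in> B} \<le> a"
    and b: "\<And>v. v \<in> A \<Longrightarrow> v \<noteq> v0 \<Longrightarrow>
      measure_pmf.prob (replicate_pmf n (pmf_of_set A)) {vs. v # vs \<in> B} \<le> b"
  shows "measure_pmf.prob (replicate_pmf (Suc n) (pmf_of_set A)) B
    \<le> 1 / real (card A) * a + (1 - 1 / real (card A)) * b"
proof -
  let ?R = "replicate_pmf n (pmf_of_set A)"
  let ?g = "\<lambda>v. measure_pmf.prob ?R {vs. v # vs \<in> B}"
  have ne: "A \<noteq> {}" and card: "card A > 0" using A v0 by (auto simp: card_gt_0_iff)
  have "replicate_pmf (Suc n) (pmf_of_set A) = bind_pmf (pmf_of_set A) (\<lambda>v. map_pmf (Cons v) ?R)"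
    by (simp add: map_pmf_def)
  then have "measure_pmf.prob (replicate_pmf (Suc n) (pmf_of_set A)) B =
      measure_pmf.expectation (pmf_of_set A) (\<lambda>v. measure_pmf.prob (map_pmf (Cons v) ?R) B)"
    by (simp only: measure_pmf_bind)
       (subst measure_pmf.measure_bind[where N = "count_space UNIV"], auto simp: measure_subprob)
  also have "\<dots> = (\<Sum>v\<in>A. ?g v) / card A"
    using A ne by (simp add: integral_pmf_of_set vimage_def)
  also have "(\<Sum>v\<in>A. ?g v) = ?g v0 + (\<Sum>v\<in>A - {v0}. ?g v)" by (rule sum.remove[OF A v0])
  also have "\<dots> \<le> a + (\<Sum>v\<in>A - {v0}. b)" using a b by (intro add_mono sum_mono) auto
  also have "\<dots> = a + (real (card A) - 1) * b"
    using A v0 card by (simp add: card_Diff_singleton of_nat_diff)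
  finally show ?thesis using card by (simp add: field_simps divide_right_mono)
qed

section \<open>The recursion on rows and columns\<close>

definition list_matroid :: "nat \<Rightarrow> 'a::field vec list \<Rightarrow> nat indep_sys" where
  "list_matroid m vs = fam_matroid m {0..<length vs} (\<lambda>j i. vs ! j $ i)"

lemma col_matroid_mat_of_cols: "col_matroid (mat_of_cols m vs) = list_matroid m vs"
  unfolding col_matroid_eq_fam list_matroid_def
  by (auto intro!: fam_matroid_cong simp: mat_of_cols_index)

lemma matroid_list_matroid: "matroid (list_matroid m vs)"
  by (metis col_matroid_mat_of_cols matroid_col_matroid)

section \<open>Deleting and contracting columns of a list\<close>

lemma bij_betw_skip:
  assumes "p \<le> n"
  shows "bij_betw (skip p) {0..<n} ({0..<Suc n} - {p})"
  unfolding bij_betw_def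
proof
  show "inj_on (skip p) {0..<n}" by (auto simp: inj_on_def skip_def split: if_splits)
  show "skip p ` {0..<n} = {0..<Suc n} - {p}"
  proof (intro equalityI subsetI)
    fix j assume j: "j \<in> {0..<Suc n} - {p}"
    then have "j < Suc n" "p < Suc n" using assms by auto
    then show "j \<in> skip p ` {0..<n}" using j by (cases rule: skip_cases) auto
  qed (auto simp: skip_def)
qed

lemma nth_append_skip: "(us @ v # vs) ! skip (length us) j = (us @ vs) ! j"
  by (auto simp: skip_def nth_append Suc_diff_le)

text \<open>Removing position \<open>length us\<close> leaves a gap in the ground set, which
  \<open>skip\<close> closes. Deletion and contraction of a column share this renumbering.\<close>

lemma is_minor_list_matroid:
  assumes el: "elem_minor (list_matroid m (us @ v # vs)) N"
    and N: "N = fam_matroid k ({0..<Suc (length (us @ vs))} - {length us}) w"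
    and ws: "length ws = length (us @ vs)"
    and w: "\<And>j i. j < length ws \<Longrightarrow> i < k \<Longrightarrow> w (skip (length us) j) i = ws ! j $ i"
  shows "is_minor (list_matroid k ws) (list_matroid m (us @ v # vs))"
proof -
  have "matroid N"
    using el matroid_del_elem[OF matroid_list_matroid] matroid_contract_elem[OF matroid_list_matroid]
    unfolding elem_minor_def by metis
  then have "isomorphic (list_matroid k ws) N"
    unfolding N using bij_betw_skip[of "length us" "length (us @ vs)"] ws w
    by (intro isomorphic_fam[OF matroid_list_matroid])
       (auto simp: list_matroid_def intro!: fam_matroid_cong)
  then show ?thesis unfolding is_minor_def using el by blast
qed

lemma is_minor_delete_col: "is_minor (list_matroid m (us @ vs)) (list_matroid m (us @ v # vs))"
proof (rule is_minor_list_matroid)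
  let ?w = "\<lambda>j i. (us @ v # vs) ! j $ i"
  show "elem_minor (list_matroid m (us @ v # vs))
      (fam_matroid m ({0..<Suc (length (us @ vs))} - {length us}) ?w)"
    unfolding elem_minor_def list_matroid_def
    by (intro bexI[of _ "length us"]) (simp_all add: del_elem_fam)
  show "(us @ v # vs) ! skip (length us) j $ i = (us @ vs) ! j $ i" for j i
    by (simp only: nth_append_skip)
qed simp_all

lemma is_minor_quot_vec:
  assumes "p < Suc m" "v $ p \<noteq> 0"
  shows "is_minor (list_matroid m (map (quot_vec m p v) vs)) (list_matroid (Suc m) (v # vs))"
proof -
  let ?w = "\<lambda>j i. (v # vs) ! j $ i"
  let ?w' = "quot_line p (?w 0) \<circ> ?w"
  have "elem_minor (list_matroid (Suc m) ([] @ v # vs))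
      (fam_matroid m ({0..<Suc (length ([] @ vs))} - {length []}) ?w')"
    unfolding elem_minor_def list_matroid_def
    using contract_elem_fam[of "{0..<Suc (length vs)}" 0 p m ?w] assms
    by (intro bexI[of _ 0]) simp_all
  then show ?thesis
    using is_minor_list_matroid[of "Suc m" "[]" v vs _ m ?w' "map (quot_vec m p v) vs"]
    by (simp add: skip_def quot_vec_def)
qed

text \<open>The prefix \<open>us\<close> lets the induction delete columns to the right of those already matched.\<close>

lemma list_matroid_subseq:
  assumes "minor_closed \<M>" "subseq bs vs" "list_matroid m (us @ vs) \<in> \<M>"
  shows "list_matroid m (us @ bs) \<in> \<M>"
proof -
  have delete: "list_matroid m (us @ vs) \<in> \<M>" if "list_matroid m (us @ v # vs) \<in> \<M>" for us v vs
    using assms(1) that is_minor_delete_col unfolding minor_closed_def by blast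
  show ?thesis
    using assms(2,3)
  proof (induction arbitrary: us rule: list_emb.induct)
    case (list_emb_Nil ys)
    then show ?case by (induction ys) (auto dest: delete)
  next
    case (list_emb_Cons xs ys y)
    then show ?case by (blast dest: delete)
  next
    case (list_emb_Cons2 x y xs ys)
    then show ?case using list_emb_Cons2.IH[of "us @ [x]"] by simp
  qed
qed

text \<open>Greedy matching with weight \<open>2 ^ length bs\<close>: a first column equal to the
  head of \<open>bs\<close>, of probability \<open>x\<close>, halves the weight. Each column thus
  contributes a factor \<open>x / 2 + (1 - x) = 1 - x / 2\<close>, at most \<open>r\<close>.\<close>

lemma prob_not_subseq_le:
  fixes bs :: "'a::{field,finite} vec list"
  assumes r: "1 - 1 / (2 * real CARD('a) ^ k) \<le> r"
    and "set bs \<subseteq> carrier_vec k"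
  shows "measure_pmf.prob (replicate_pmf n (uniform_vec k)) {vs. \<not> subseq bs vs}
    \<le> 2 ^ length bs * r ^ n"
  using assms(2)
proof (induction n arbitrary: bs)
  case 0
  have "measure_pmf.prob (replicate_pmf 0 (uniform_vec k)) {vs. \<not> subseq bs vs} \<le> 1"
    by (rule measure_pmf.prob_le_1)
  also have "1 \<le> (2::real) ^ length bs" by simp
  finally show ?case by simp
next
  case (Suc n)
  define x where "x = 1 / real CARD('a) ^ k"
  have "1 \<le> real CARD('a) ^ k" by (intro one_le_power) (simp add: Suc_le_eq)
  then have x: "0 < x" "x \<le> 1" "1 - x / 2 \<le> r" using r by (auto simp: x_def)
  then have r0: "0 \<le> r" by linarith
  show ?case
  proof (cases bs)
    case Nil
    then show ?thesis using r0 by simp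
  next
    case (Cons b bs')
    let ?P = "\<lambda>n bs. measure_pmf.prob (replicate_pmf n (uniform_vec k)) {vs. \<not> subseq bs vs}"
    have "?P (Suc n) bs \<le> x * (2 ^ length bs' * r ^ n) + (1 - x) * (2 ^ length bs * r ^ n)"
      unfolding uniform_vec_def x_def of_nat_power[symmetric] card_carrier_vec[symmetric]
    proof (rule prob_replicate_Suc_le[OF finite_carrier_vec, of b])
      show "b \<in> carrier_vec k" using Suc.prems Cons by simp
      show "measure_pmf.prob (replicate_pmf n (pmf_of_set (carrier_vec k)))
          {vs. b # vs \<in> {vs. \<not> subseq bs vs}} \<le> 2 ^ length bs' * r ^ n"
        using Suc.IH[of bs'] Suc.prems Cons by (simp add: uniform_vec_def)
      show "measure_pmf.prob (replicate_pmf n (pmf_of_set (carrier_vec k)))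
          {vs. v # vs \<in> {vs. \<not> subseq bs vs}} \<le> 2 ^ length bs * r ^ n" if "v \<noteq> b" for v
        using Suc.IH[of bs] Suc.prems Cons that by (simp add: uniform_vec_def)
    qed
    also have "\<dots> = 2 ^ length bs * r ^ n * (1 - x / 2)"
      by (simp add: Cons algebra_simps)
    also have "\<dots> \<le> 2 ^ length bs * r ^ n * r" using x r0 by (intro mult_left_mono) auto
    finally show ?thesis by (simp add: mult_ac)
  qed
qed

text \<open>A zero first column is deleted. A nonzero one is contracted, and the quotients of the
  remaining columns are again independent and uniform with one row fewer.\<close>

lemma prob_mem_Suc_le:
  fixes \<M> :: "nat indep_sys set"
  assumes mc: "minor_closed \<M>"
  defines "P \<equiv> \<lambda>m n. measure_pmf.prob (replicate_pmf n (uniform_vec m :: 'a::{field,finite} vec pmf))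
    {vs. list_matroid m vs \<in> \<M>}"
  shows "P (Suc m) (Suc n) \<le>
    1 / real CARD('a) ^ Suc m * P (Suc m) n + (1 - 1 / real CARD('a) ^ Suc m) * P m n"
  unfolding P_def uniform_vec_def[of "Suc m"] of_nat_power[symmetric] card_carrier_vec[symmetric]
proof (rule prob_replicate_Suc_le[OF finite_carrier_vec, of "0\<^sub>v (Suc m)"])
  let ?R = "replicate_pmf n (pmf_of_set (carrier_vec (Suc m) :: 'a vec set))"
  have "{vs. 0\<^sub>v (Suc m) # vs \<in> {vs. list_matroid (Suc m) vs \<in> \<M>}} \<subseteq>
      {vs. list_matroid (Suc m) vs \<in> \<M>}"
    using mc is_minor_delete_col[of "Suc m" "[]"] unfolding minor_closed_def by fastforce
  then show "measure_pmf.prob ?R {vs. 0\<^sub>v (Suc m) # vs \<in> {vs. list_matroid (Suc m) vs \<in> \<M>}} \<le>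
      measure_pmf.prob ?R {vs. list_matroid (Suc m) vs \<in> \<M>}"
    by (rule measure_pmf.finite_measure_mono) simp
next
  let ?R = "replicate_pmf n (pmf_of_set (carrier_vec (Suc m) :: 'a vec set))"
  fix v :: "'a vec" assume v: "v \<in> carrier_vec (Suc m)" "v \<noteq> 0\<^sub>v (Suc m)"
  \<comment> \<open>The pivot depends on \<open>v\<close>, but the law of the quotient does not, so
    a single bound covers all nonzero \<open>v\<close>.\<close>
  then obtain p where p: "p < Suc m" "v $ p \<noteq> 0" by (auto simp: vec_eq_iff)
  let ?q = "quot_vec m p v"
  have "{vs. v # vs \<in> {vs. list_matroid (Suc m) vs \<in> \<M>}} \<subseteq> map ?q -` {vs. list_matroid m vs \<in> \<M>}"
    using mc is_minor_quot_vec[OF p] unfolding minor_closed_def by fastforce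
  then have "measure_pmf.prob ?R {vs. v # vs \<in> {vs. list_matroid (Suc m) vs \<in> \<M>}} \<le>
      measure_pmf.prob ?R (map ?q -` {vs. list_matroid m vs \<in> \<M>})"
    by (rule measure_pmf.finite_measure_mono) simp
  also have "\<dots> = measure_pmf.prob (map_pmf (map ?q) ?R) {vs. list_matroid m vs \<in> \<M>}"
    by simp
  also have "map_pmf (map ?q) ?R = replicate_pmf n (uniform_vec m)"
    using map_quot_vec_uniform[OF p(1), of v] by (simp add: map_replicate_pmf uniform_vec_def)
  finally show "measure_pmf.prob ?R {vs. v # vs \<in> {vs. list_matroid (Suc m) vs \<in> \<M>}} \<le>
      measure_pmf.prob (replicate_pmf n (uniform_vec m :: 'a vec pmf))
        {vs. list_matroid m vs \<in> \<M>}" .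
qed simp

section \<open>The geometric bound\<close>

text \<open>After cancelling, the claim is \<open>x\<close> times
  \<open>2 - x \<le> r * (1 + q - q * x)\<close>. At \<open>q = 2\<close>, \<open>x = 1 / 2\<close>,
  \<open>r = 3 / 4\<close> this is an equality, which is the origin of 3/4.\<close>

lemma weighted_step:
  fixes q r x :: real
  assumes "2 \<le> q" "3 / 4 \<le> r" "0 \<le> x" "x \<le> 1 / 2"
  shows "x * (2 - x) + (1 - x) * (2 - q * x) * r \<le> (2 - x) * r"
proof -
  have "q * x \<le> q * 1" using assms by (intro mult_left_mono) auto
  then have "0 \<le> 1 + q - q * x" by linarith
  then have "3 / 4 * (1 + q - q * x) \<le> r * (1 + q - q * x)"
    by (rule mult_right_mono[OF assms(2)])
  \<comment> \<open>The remaining inequality is linear in \<open>x\<close> with slope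
    \<open>3 * q - 4 > 0\<close>, so \<open>x = 1 / 2\<close> is the worst case.\<close>
  moreover have "(3 * q - 4) * x \<le> (3 * q - 4) * (1 / 2)"
    using assms by (intro mult_left_mono) auto
  then have "2 - x \<le> 3 / 4 * (1 + q - q * x)"
    using assms(1) by argo
  ultimately have "2 - x \<le> r * (1 + q - q * x)" by linarith
  then have "x * (2 - x) \<le> x * (r * (1 + q - q * x))" using assms by (intro mult_left_mono)
  then show ?thesis by (simp add: algebra_simps)
qed

text \<open>The weight \<open>2 - 1 / q ^ m\<close> increases with \<open>m\<close> but stays below
  2; its increase absorbs the loss from a deleted zero column, so the constant does not grow with
  \<open>m\<close>. The weight is at least 1, which settles \<open>d = 0\<close>.\<close>

lemma geometric_bound:
  fixes P :: "nat \<Rightarrow> nat \<Rightarrow> real"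
  assumes q: "2 \<le> q" and r: "3 / 4 \<le> r" and C: "1 \<le> C"
    and base: "\<And>d. P k (k + d) \<le> C * r ^ d"
    and one: "\<And>m n. P m n \<le> 1"
    and step: "\<And>m n. P (Suc m) (Suc n) \<le> 1 / q ^ Suc m * P (Suc m) n + (1 - 1 / q ^ Suc m) * P m n"
    and "k \<le> m"
  shows "P m (m + d) \<le> C * (2 - 1 / q ^ m) * r ^ d"
proof -
  have pow: "1 \<le> q ^ m" for m using q by (intro one_le_power) simp
  have le: "1 \<le> 2 - 1 / q ^ m" for m using pow[of m] by (simp add: divide_le_eq)
  from assms(7) show ?thesis
  proof (induction m arbitrary: d rule: dec_induct)
    case base
    have "C * r ^ d * 1 \<le> C * r ^ d * (2 - 1 / q ^ k)"
      using C r le by (intro mult_left_mono) auto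
    then show ?case using assms(4)[of d] by (simp add: mult_ac)
  next
    case (step m)
    define x where "x = 1 / q ^ Suc m"
    have x1: "q * x = 1 / q ^ m" using q by (simp add: x_def)
    have "2 * 1 \<le> q * q ^ m" using q pow by (intro mult_mono) auto
    then have x: "0 \<le> x" "x \<le> 1 / 2" using q by (auto simp: x_def divide_simps)
    show ?case
    proof (induction d)
      case 0
      have "1 * 1 \<le> C * (2 - 1 / q ^ Suc m)" using C by (intro mult_mono le) auto
      then show ?case using one[of "Suc m" "Suc m"] by simp
    next
      case (Suc d)
      \<comment> \<open>Contraction removes a row and a column and keeps the surplus
        \<open>Suc d\<close>; deletion lowers the surplus to \<open>d\<close>. Both terms are
        covered by induction hypotheses.\<close>
      have "P (Suc m) (Suc m + Suc d) \<le> x * P (Suc m) (Suc m + d) + (1 - x) * P m (m + Suc d)"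
        using assms(6)[of m "Suc m + d"] by (simp add: x_def)
      also have "\<dots> \<le> x * (C * (2 - x) * r ^ d) + (1 - x) * (C * (2 - q * x) * r ^ Suc d)"
        using Suc.IH step.IH[of "Suc d"] x unfolding x1
        by (intro add_mono mult_left_mono) (auto simp: x_def)
      also have "\<dots> = C * r ^ d * (x * (2 - x) + (1 - x) * (2 - q * x) * r)"
        by (simp add: algebra_simps)
      also have "\<dots> \<le> C * r ^ d * ((2 - x) * r)"
        using weighted_step[OF q r x] C r by (intro mult_left_mono) auto
      finally show ?case by (simp add: x_def mult_ac)
    qed
  qed
qed

lemma prob_mem_le:
  fixes \<M> :: "nat indep_sys set" and N :: "nat indep_sys"
  assumes mc: "minor_closed \<M>" and N: "representable TYPE('a::{field,finite}) N" "N \<notin> \<M>"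
  shows "\<exists>C r. 0 \<le> r \<and> r < 1 \<and> (\<forall>m d. matroid_rank N \<le> m \<longrightarrow>
    measure_pmf.prob (uniform_mat m (m + d) :: 'a mat pmf) {A. col_matroid A \<in> \<M>} \<le> C * r ^ d)"
proof -
  let ?k = "matroid_rank N" and ?q = "real CARD('a)"
  define P where "P = (\<lambda>m n. measure_pmf.prob (replicate_pmf n (uniform_vec m :: 'a vec pmf))
    {vs. list_matroid m vs \<in> \<M>})"
  obtain B :: "'a mat" where iso: "isomorphic N (col_matroid B)"
    using N(1) unfolding representable_def by blast
  have "matroid_rank (col_matroid B) \<le> ?k" using rank_isomorphic[OF iso] by simp
  then obtain w :: "nat \<Rightarrow> nat \<Rightarrow> 'a" where w: "fam_matroid ?k {0..<dim_col B} w = col_matroid B"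
    unfolding col_matroid_eq_fam using fam_matroid_rows by blast
  \<comment> \<open>The columns of a representation of \<open>N\<close> with exactly
    \<open>?k\<close> rows; their matroid is outside the class because it has \<open>N\<close> as a
    minor.\<close>
  define bs where "bs = map (\<lambda>j. vec ?k (w j)) [0..<dim_col B]"
  have "list_matroid ?k bs = fam_matroid ?k {0..<dim_col B} w"
    by (auto simp: list_matroid_def bs_def intro!: fam_matroid_cong)
  moreover have "is_minor N (col_matroid B)" unfolding is_minor_def using iso by blast
  ultimately have bs: "list_matroid ?k bs \<notin> \<M>"
    using mc N(2) w unfolding minor_closed_def by metis
  have car: "set bs \<subseteq> carrier_vec ?k" by (auto simp: bs_def)
  have "card {0, 1 :: 'a} \<le> CARD('a)" by (rule card_mono) auto
  then have q: "2 \<le> ?q" by simp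
  \<comment> \<open>The value 3/4 serves \<open>weighted_step\<close>, the other one the subsequence
    bound; neither depends on \<open>m\<close>.\<close>
  define r where "r = max (3 / 4) (1 - 1 / (2 * ?q ^ ?k))"
  have r: "3 / 4 \<le> r" "1 - 1 / (2 * ?q ^ ?k) \<le> r" "r < 1" by (auto simp: r_def)
  have base: "P ?k (?k + d) \<le> 2 ^ length bs * r ^ d" for d
  proof -
    \<comment> \<open>If \<open>bs\<close> occurred in order, deleting the other columns would put
      its matroid into the class.\<close>
    have "{vs. list_matroid ?k vs \<in> \<M>} \<subseteq> {vs. \<not> subseq bs vs}"
      using list_matroid_subseq[OF mc, where us = "[]"] bs by auto
    then have "P ?k (?k + d) \<le>
        measure_pmf.prob (replicate_pmf (?k + d) (uniform_vec ?k)) {vs. \<not> subseq bs vs}"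
      unfolding P_def by (rule measure_pmf.finite_measure_mono) simp
    also have "\<dots> \<le> 2 ^ length bs * r ^ (?k + d)" by (rule prob_not_subseq_le[OF r(2) car])
    also have "\<dots> \<le> 2 ^ length bs * r ^ d"
      using r by (intro mult_left_mono power_decreasing) auto
    finally show ?thesis .
  qed
  have bound: "P m (m + d) \<le> (2 * 2 ^ length bs) * r ^ d" if "?k \<le> m" for m d
  proof -
    have "P m (m + d) \<le> 2 ^ length bs * (2 - 1 / ?q ^ m) * r ^ d"
    proof (rule geometric_bound[where P = P and k = ?k, OF q r(1) _ base _ _ that])
      show "P m n \<le> 1" for m n by (simp add: P_def)
      show "P (Suc m) (Suc n) \<le> 1 / ?q ^ Suc m * P (Suc m) n + (1 - 1 / ?q ^ Suc m) * P m n" for m n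
        unfolding P_def by (rule prob_mem_Suc_le[OF mc])
    qed simp
    also have "\<dots> \<le> 2 ^ length bs * 2 * r ^ d"
      using r q by (intro mult_right_mono mult_left_mono) auto
    finally show ?thesis by (simp add: mult_ac)
  qed
  have "measure_pmf.prob (uniform_mat m n :: 'a mat pmf) {A. col_matroid A \<in> \<M>} = P m n" for m n
    by (simp add: P_def uniform_mat_eq_map vimage_def col_matroid_mat_of_cols)
  then show ?thesis using bound r by (intro exI[of _ "2 * 2 ^ length bs"] exI[of _ r]) auto
qed

section \<open>Passage to the limit\<close>

theorem theorem9:
  fixes \<M> :: "nat indep_sys set"
    and m :: "nat \<Rightarrow> nat"
  assumes "representable_class TYPE('a::{field,finite}) \<M>"
    and "minor_closed \<M>"
    and "proper_class TYPE('a) \<M>"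
    and "\<forall>\<^sub>F n in sequentially. m n \<ge> min_excluded_rank TYPE('a) \<M>"
    and "filterlim (\<lambda>n. int n - int (m n)) at_top sequentially"
  shows "(\<lambda>n. measure_pmf.prob (uniform_mat (m n) n :: 'a mat pmf) {A. col_matroid A \<notin> \<M>})
           \<longlonglongrightarrow> 1"
proof -
  let ?P = "\<lambda>n. measure_pmf.prob (uniform_mat (m n) n :: 'a mat pmf) {A. col_matroid A \<in> \<M>}"
  \<comment> \<open>The least rank is attained because a representable excluded minor
    exists.\<close>
  obtain N where N: "representable TYPE('a) N" "excluded_minor \<M> N"
      "matroid_rank N = min_excluded_rank TYPE('a) \<M>"
    using representable_excluded_minor_exists[OF assms(2,3)]
      LeastI_ex[of "\<lambda>k. \<exists>N. representable TYPE('a) N \<and> excluded_minor \<M> N \<and> matroid_rank N = k"]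
    unfolding min_excluded_rank_def by blast
  obtain C r where r: "0 \<le> r" "r < 1" and bound: "\<And>m d. matroid_rank N \<le> m \<Longrightarrow>
      measure_pmf.prob (uniform_mat m (m + d) :: 'a mat pmf) {A. col_matroid A \<in> \<M>} \<le> C * r ^ d"
    using prob_mem_le[OF assms(2) N(1)] N(2) unfolding excluded_minor_def by blast
  have "filterlim (\<lambda>n. nat (int n - int (m n))) sequentially sequentially"
    by (rule filterlim_compose[OF filterlim_nat_sequentially assms(5)])
  then have "(\<lambda>n. r ^ nat (int n - int (m n))) \<longlonglongrightarrow> 0"
    using r by (intro filterlim_compose[OF LIMSEQ_realpow_zero])
  then have lim: "(\<lambda>n. C * r ^ nat (int n - int (m n))) \<longlonglongrightarrow> 0"
    by (rule tendsto_mult_right_zero)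
  \<comment> \<open>Eventually \<open>m n \<le> n\<close>, so \<open>nat\<close> does not truncate
    and \<open>n\<close> is \<open>m n\<close> plus the surplus.\<close>
  have "\<forall>\<^sub>F n in sequentially. 0 \<le> int n - int (m n)"
    using assms(5) unfolding filterlim_at_top by blast
  then have "\<forall>\<^sub>F n in sequentially. ?P n \<le> C * r ^ nat (int n - int (m n))"
    using assms(4)
  proof eventually_elim
    case (elim n)
    then have "n = m n + nat (int n - int (m n))" by simp
    then show ?case using bound[of "m n" "nat (int n - int (m n))"] elim N(3) by simp
  qed
  then have "?P \<longlonglongrightarrow> 0"
    by (intro tendsto_sandwich[OF _ _ tendsto_const lim]) auto
  then have "(\<lambda>n. 1 - ?P n) \<longlonglongrightarrow> 1 - 0" by (intro tendsto_intros)
  moreover have "1 - ?P n =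
      measure_pmf.prob (uniform_mat (m n) n :: 'a mat pmf) {A. col_matroid A \<notin> \<M>}" for n
    by (subst measure_pmf.prob_compl[symmetric]) (auto intro!: arg_cong2[where f = measure])
  ultimately show ?thesis by simp
qed

end
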